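(* The matrix $A$ is Lyapunov stable if and only if $$0<\sigma_2,\qquad 0<\phi_1,\qquad 0<\phi_2,\qquad 0<\phi_2^2-16\phi_1,$$ where $\phi_1=\sigma_1\sigma_3$ and $\phi_2=3\sigma_1+\sigma_3\sigma_1+1$.
   Context: Let $J_x,J_y,J_z>0$ (inertias of the spacecraft) and $\omega_0>0$ (orbital rate) be real numbers, and set $$\sigma_1=\frac{J_y-J_z}{J_x},\qquad \sigma_2=\frac{J_x-J_z}{J_y},\qquad \sigma_3=\frac{J_y-J_x}{J_z}.$$ The matrix $A$ (state matrix of the linearized spacecraft attitude control system) is $$A=\begin{bmatrix}0&0&0&1&0&0\\0&0&0&0&1&0\\0&0&0&0&0&1\\-4\omega_0^2\sigma_1&0&0&0&0&\omega_0(1-\sigma_1)\\0&-3\omega_0^2\sigma_2&0&0&0&0\\0&0&-\omega_0^2\sigma_3&\omega_0(\sigma_3-1)&0&0\end{bmatrix}\in\mathbb{R}^{6\times 6}.$$ A real square matrix is called Lyapunov stable (or neutrally stable) if all its eigenvalues have non-positive real parts and every eigenvalue on the imaginary axis has equal algebraic and geometric multiplicities. *)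

theory Defs
  imports
    Complex_Main
    "Jordan_Normal_Form.Char_Poly"
    "Jordan_Normal_Form.Matrix_Kernel"
begin

definition algebraic_multiplicity :: "complex mat \<Rightarrow> complex \<Rightarrow> nat" where
  "algebraic_multiplicity M l = Polynomial.order l (char_poly M)"

(* char_matrix M l is M - l * I, so its kernel is the eigenspace of l. *)
definition geometric_multiplicity :: "complex mat \<Rightarrow> complex \<Rightarrow> nat" where
  "geometric_multiplicity M l = kernel_dim (char_matrix M l)"

(* The eigenvalues of a real matrix are its complex ones, hence the embedding into
   complex matrices. *)
definition lyapunov_stable :: "real mat \<Rightarrow> bool" where
  "lyapunov_stable A \<longleftrightarrow>
     (let M = map_mat complex_of_real A in
      square_mat A \<and>
      (\<forall>l. eigenvalue M l \<longrightarrow> Re l \<le> 0) \<and>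
      (\<forall>l. eigenvalue M l \<and> Re l = 0 \<longrightarrow>
         algebraic_multiplicity M l = geometric_multiplicity M l))"

definition attitude_matrix :: "real \<Rightarrow> real \<Rightarrow> real \<Rightarrow> real \<Rightarrow> real mat" where
  "attitude_matrix \<omega>\<^sub>0 \<sigma>\<^sub>1 \<sigma>\<^sub>2 \<sigma>\<^sub>3 = mat_of_rows_list 6
     [[0, 0, 0, 1, 0, 0],
      [0, 0, 0, 0, 1, 0],
      [0, 0, 0, 0, 0, 1],
      [- 4 * \<omega>\<^sub>0\<^sup>2 * \<sigma>\<^sub>1, 0, 0, 0, 0, \<omega>\<^sub>0 * (1 - \<sigma>\<^sub>1)],
      [0, - 3 * \<omega>\<^sub>0\<^sup>2 * \<sigma>\<^sub>2, 0, 0, 0, 0],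
      [0, 0, - \<omega>\<^sub>0\<^sup>2 * \<sigma>\<^sub>3, \<omega>\<^sub>0 * (\<sigma>\<^sub>3 - 1), 0, 0]]"

end

theory Submission
  imports
    Defs
    "Jordan_Normal_Form.Jordan_Normal_Form_Uniqueness"
    "Jordan_Normal_Form.Jordan_Normal_Form_Existence"
    "Jordan_Normal_Form.Spectral_Radius"
begin

text \<open>
  The state \<open>(x, y, z, x', y', z')\<close> consists of the roll, pitch and yaw angles and their rates.
  Pitch is an oscillator of its own, \<open>y'' = - c y\<close>, and roll and yaw form a pair
  \<open>x'' = - a x + g z'\<close>, \<open>z'' = - b z + h x'\<close>. Inserting \<open>exp (l t)\<close> turns the second pair into
  \<open>P(l) (x, z) = 0\<close> for the pencil \<open>P(l) = (l\<^sup>2 + a, - g l; - h l, l\<^sup>2 + b)\<close>. Hence the eigenvalues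
  of \<open>A\<close> are the roots of \<open>l\<^sup>2 + c\<close> and of \<open>D(l) = det P(l)\<close> (lemma \<open>eigenvalue_iff\<close>). The
  second polynomial is \<open>(l\<^sup>2)\<^sup>2 + p l\<^sup>2 + q\<close> with \<open>p = \<omega>\<^sub>0\<^sup>2 \<phi>\<^sub>2\<close> and \<open>q = 4 \<omega>\<^sub>0\<^sup>4 \<phi>\<^sub>1\<close>.

  The spectrum is symmetric under \<open>l \<mapsto> - l\<close>, so it lies in the closed left half plane only if it
  lies on the imaginary axis, that is, only if every \<open>l\<^sup>2\<close> is real and non-positive. For a real
  quadratic this means \<open>p \<ge> 0\<close>, \<open>q \<ge> 0\<close> and \<open>p\<^sup>2 - 4 q \<ge> 0\<close>. What remains is to see that the
  equalities in \<open>c \<ge> 0\<close>, \<open>q \<ge> 0\<close> and \<open>p\<^sup>2 - 4 q \<ge> 0\<close> are exactly what the condition on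
  multiplicities rules out; \<open>p > 0\<close> then follows from \<open>p\<^sup>2 > 4 q > 0\<close>.

  Multiplicities are treated without computing the characteristic polynomial: by the Jordan normal
  form they agree at \<open>l\<close> if and only if there is no Jordan chain of length two there
  (lemma \<open>algebraic_eq_geometric_iff_no_jordan_chain\<close>). For the pencil, such a chain is a pair with
  \<open>P(l) u = 0\<close> and \<open>P(l) x + P'(l) u = 0\<close>. With the adjugate \<open>adj P\<close>, the derivative of
  \<open>adj P * P = D I\<close> shows that a simple root of \<open>D\<close> has no chain
  (lemma \<open>multiplicities_eq_if_simple\<close>), and the derivative of \<open>P * adj P = D I\<close> shows that at a
  double root the columns of \<open>adj P\<close> and of its derivative form chains, so that \<open>P\<close> must vanish
  there (lemma \<open>roll_yaw_decoupled_if_multiplicities_eq\<close>). For the spacecraft this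
  never happens: \<open>P(0) = 0\<close> would make all inertias equal, and then \<open>c = 0\<close>; and \<open>P(l) = 0\<close> with
  \<open>l \<noteq> 0\<close> would give \<open>\<sigma>\<^sub>1 = \<sigma>\<^sub>3 = 1\<close>, hence both \<open>l\<^sup>2 = - 4 \<omega>\<^sub>0\<^sup>2\<close> and \<open>l\<^sup>2 = - \<omega>\<^sub>0\<^sup>2\<close>.
\<close>

section \<open>Multiplicities and Jordan chains\<close>

text \<open>A basis of the smaller kernel is independent in the larger one and already has full size.\<close>
lemma mat_kernel_eq_if_subset_if_kernel_dim_eq:
  fixes B C :: "'a :: field mat"
  assumes B: "B \<in> carrier_mat nr n" and C: "C \<in> carrier_mat nr' n"
    and sub: "mat_kernel B \<subseteq> mat_kernel C" and dim: "kernel_dim B = kernel_dim C"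
  shows "mat_kernel B = mat_kernel C"
proof -
  interpret KB: kernel nr n B by unfold_locales (rule B)
  interpret KC: kernel nr' n C by unfold_locales (rule C)
  obtain S where S: "finite S" "KB.basis S" using kernel_basis_exists[OF B] by blast
  obtain T where T: "finite T" "KC.basis T" using kernel_basis_exists[OF C] by blast
  have SB: "S \<subseteq> mat_kernel B" using S unfolding KB.Ker.basis_def by auto
  have "KC.lin_indpt S"
    using S(2) KB.lindep_same[OF SB] KC.lindep_same[OF order_trans[OF SB sub]]
    unfolding KB.Ker.basis_def by auto
  moreover have "KC.Ker.fin_dim" using T unfolding KC.Ker.fin_dim_def KC.Ker.basis_def by auto
  moreover have "card S = KC.dim" using KB.Ker.dim_basis[OF S] dim by simp
  ultimately have "KC.basis S"
    using S(1) SB sub by (intro KC.Ker.dim_li_is_basis) auto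
  then have "mat_kernel C = KB.NC.span S"
    using KC.span_same[OF order_trans[OF SB sub]] unfolding KC.Ker.basis_def by auto
  moreover have "mat_kernel B = KB.NC.span S"
    using S(2) KB.span_same[OF SB] unfolding KB.Ker.basis_def by auto
  ultimately show ?thesis by simp
qed

text \<open>
  The numbers stand for the sizes of the Jordan blocks of one eigenvalue. Both equations say that
  every block has size one: a block of size \<open>n\<close> contributes \<open>n\<close> to the algebraic multiplicity and
  \<open>min k n\<close> to the dimension of the kernel of the \<open>k\<close>-th power.
\<close>
lemma sum_list_eq_sum_list_min_iff:
  fixes ns :: "nat list"
  assumes "0 \<notin> set ns"
  shows "sum_list ns = sum_list (map (min 1) ns) \<longleftrightarrow>
    sum_list (map (min 1) ns) = sum_list (map (min 2) ns)"
proof -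
  have le: "sum_list (map (min 1) ns) \<le> sum_list (map (min 2) ns)"
    "sum_list (map (min 2) ns) \<le> sum_list ns" for ns :: "nat list"
    by (induction ns) (auto simp: min_def)
  show ?thesis using assms
  proof (induction ns)
    case (Cons n ns)
    then consider "n = 1" | "n \<ge> 2" by fastforce
    then show ?case
    proof cases
      case 2
      \<comment> \<open>The block makes both equations false, since every other one contributes monotonically.\<close>
      then show ?thesis using le[of ns] by auto
    qed (use Cons in auto)
  qed simp
qed

text \<open>
  Algebraic and geometric multiplicity agree if and only if all Jordan blocks of \<open>l\<close> have size one,
  and a larger block is visible in the kernel growing from \<open>M - l I\<close> to its square. This trades the
  order of a root of the characteristic polynomial for linear equations.
\<close>
lemma algebraic_eq_geometric_iff_no_jordan_chain:
  fixes M :: "complex mat"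
  assumes M: "M \<in> carrier_mat n n"
  shows "algebraic_multiplicity M l = geometric_multiplicity M l \<longleftrightarrow>
    (\<forall>v \<in> carrier_vec n. char_matrix M l *\<^sub>v (char_matrix M l *\<^sub>v v) = 0\<^sub>v n \<longrightarrow>
       char_matrix M l *\<^sub>v v = 0\<^sub>v n)"
proof -
  let ?B = "char_matrix M l"
  have B: "?B \<in> carrier_mat n n" using M by simp
  obtain as where "char_poly M = (\<Prod>a\<leftarrow>as. [:- a, 1:])" using char_poly_factorized[OF M] by auto
  from jordan_nf_exists[OF M this] obtain n_as where jnf: "jordan_nf M n_as" ..
  define ns where "ns = map fst [(n, e)\<leftarrow>n_as . e = l]"
  have "0 \<notin> set ns" using jnf unfolding jordan_nf_def ns_def by force
  moreover have "algebraic_multiplicity M l = sum_list ns"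
    unfolding algebraic_multiplicity_def jordan_nf_order[OF jnf] ns_def
    by (simp add: case_prod_unfold)
  moreover have "geometric_multiplicity M l = sum_list (map (min 1) ns)"
    using dim_gen_eigenspace[OF jnf, of l 1] B
    unfolding geometric_multiplicity_def dim_gen_eigenspace_def ns_def by simp
  moreover have "kernel_dim (?B * ?B) = sum_list (map (min 2) ns)"
    using dim_gen_eigenspace[OF jnf, of l 2] B
    unfolding dim_gen_eigenspace_def ns_def by (simp add: numeral_2_eq_2)
  ultimately have "algebraic_multiplicity M l = geometric_multiplicity M l \<longleftrightarrow>
      kernel_dim ?B = kernel_dim (?B * ?B)"
    using sum_list_eq_sum_list_min_iff[of ns] unfolding geometric_multiplicity_def by simp
  also have "\<dots> \<longleftrightarrow> mat_kernel ?B = mat_kernel (?B * ?B)"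
  proof
    assume "kernel_dim ?B = kernel_dim (?B * ?B)"
    then show "mat_kernel ?B = mat_kernel (?B * ?B)"
      using mat_kernel_mult_subset[OF B B] B by (intro mat_kernel_eq_if_subset_if_kernel_dim_eq) auto
  next
    assume "mat_kernel ?B = mat_kernel (?B * ?B)"
    then show "kernel_dim ?B = kernel_dim (?B * ?B)"
      using B unfolding kernel_dim_def by simp
  qed
  also have "\<dots> \<longleftrightarrow> mat_kernel (?B * ?B) \<subseteq> mat_kernel ?B"
    using mat_kernel_mult_subset[OF B B] by auto
  also have "\<dots> \<longleftrightarrow> (\<forall>v \<in> carrier_vec n. ?B *\<^sub>v (?B *\<^sub>v v) = 0\<^sub>v n \<longrightarrow> ?B *\<^sub>v v = 0\<^sub>v n)"
    unfolding mat_kernel[OF B] mat_kernel[OF mult_carrier_mat[OF B B]]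
    using assoc_mult_mat_vec[OF B B] by fastforce
  finally show ?thesis .
qed

section \<open>States of the attitude dynamics\<close>

definition state_vec :: "complex \<Rightarrow> complex \<Rightarrow> complex \<Rightarrow> complex \<Rightarrow> complex \<Rightarrow> complex \<Rightarrow> complex vec" where
  "state_vec x y z x' y' z' = vec_of_list [x, y, z, x', y', z']"

lemma state_vec_carrier [simp]: "state_vec x y z x' y' z' \<in> carrier_vec 6"
  by (auto simp: state_vec_def intro!: carrier_vecI)

lemma carrier_vec_6E:
  assumes "v \<in> carrier_vec 6"
  obtains x y z x' y' z' where "v = state_vec x y z x' y' z'"
proof
  show "v = state_vec (v $ 0) (v $ 1) (v $ 2) (v $ 3) (v $ 4) (v $ 5)"
    using assms by (intro eq_vecI) (auto simp: state_vec_def numeral_eq_Suc less_Suc_eq)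
qed

lemma state_vec_eq_0_iff: "state_vec x y z x' y' z' = 0\<^sub>v 6 \<longleftrightarrow>
   x = 0 \<and> y = 0 \<and> z = 0 \<and> x' = 0 \<and> y' = 0 \<and> z' = 0"
  by (auto simp: vec_eq_iff state_vec_def numeral_eq_Suc All_less_Suc)

lemma char_matrix_attitude_matrix_mult:
  "char_matrix (map_mat complex_of_real (attitude_matrix w s1 s2 s3)) l *\<^sub>v state_vec x y z x' y' z' =
   state_vec (x' - l * x) (y' - l * y) (z' - l * z)
     (w * (1 - s1) * z' - 4 * w\<^sup>2 * s1 * x - l * x')
     (- 3 * w\<^sup>2 * s2 * y - l * y')
     (w * (s3 - 1) * x' - w\<^sup>2 * s3 * z - l * z')"
  by (intro eq_vecI) (auto simp: state_vec_def char_matrix_def attitude_matrix_def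
     mat_of_rows_list_def numeral_eq_Suc less_Suc_eq scalar_prod_def algebra_simps)

section \<open>A pitch oscillator next to a gyroscopically coupled roll-yaw pair\<close>

text \<open>
  The system \<open>x'' = - a x + g z'\<close>, \<open>y'' = - c y\<close>, \<open>z'' = - b z + h x'\<close> in first-order form. Its matrix is
  given through its action on states, which is the only way in which it is used; keeping the five
  coefficients opaque keeps the polynomial identities small.
\<close>
locale gyroscopic_matrix =
  fixes M :: "complex mat" and a b c g h :: complex
  assumes carrier: "M \<in> carrier_mat 6 6"
    and char_matrix_mult: "char_matrix M l *\<^sub>v state_vec x y z x' y' z' =
      state_vec (x' - l * x) (y' - l * y) (z' - l * z)
        (g * z' - a * x - l * x') (- c * y - l * y') (h * x' - b * z - l * z')"
begin

text \<open>The determinant of the pencil \<open>P(l) = (l\<^sup>2 + a, - g l; - h l, l\<^sup>2 + b)\<close>.\<close>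
definition roll_yaw_det :: "complex \<Rightarrow> complex" where
  "roll_yaw_det l = (l\<^sup>2 + a) * (l\<^sup>2 + b) - g * h * l\<^sup>2"

text \<open>The derivative in \<open>l\<close>, in the form in which Jordan chains produce it.\<close>
definition roll_yaw_det_deriv :: "complex \<Rightarrow> complex" where
  "roll_yaw_det_deriv l = 2 * l * (2 * l\<^sup>2 + a + b - g * h)"

text \<open>
  Eigenvectors are governed by their positions: the rates are \<open>l\<close> times the angles, and what is left
  is the pitch equation and \<open>P(l) (x, z) = 0\<close>.
\<close>
lemma char_matrix_mult_eq_0_iff:
  "char_matrix M l *\<^sub>v state_vec x y z x' y' z' = 0\<^sub>v 6 \<longleftrightarrow>
     x' = l * x \<and> y' = l * y \<and> z' = l * z \<and> (l\<^sup>2 + c) * y = 0 \<and>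
     (l\<^sup>2 + a) * x = g * l * z \<and> (l\<^sup>2 + b) * z = h * l * x"
proof -
  have "g * (l * z) - a * x - l * (l * x) = g * l * z - (l\<^sup>2 + a) * x"
    "h * (l * x) - b * z - l * (l * z) = h * l * x - (l\<^sup>2 + b) * z"
    "- c * y - l * (l * y) = 0 - (l\<^sup>2 + c) * y"
    by (simp_all add: algebra_simps power2_eq_square)
  then have eqs: "g * (l * z) - a * x - l * (l * x) = 0 \<longleftrightarrow> (l\<^sup>2 + a) * x = g * l * z"
    "h * (l * x) - b * z - l * (l * z) = 0 \<longleftrightarrow> (l\<^sup>2 + b) * z = h * l * x"
    "- c * y - l * (l * y) = 0 \<longleftrightarrow> (l\<^sup>2 + c) * y = 0"
    by (metis right_minus_eq)+
  show ?thesis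
  proof (cases "x' = l * x \<and> y' = l * y \<and> z' = l * z")
    case True
    then have xyz: "x' = l * x" "y' = l * y" "z' = l * z" by simp_all
    show ?thesis
      unfolding char_matrix_mult state_vec_eq_0_iff xyz eqs by auto
  qed (auto simp: char_matrix_mult state_vec_eq_0_iff)
qed

text \<open>This is \<open>adj P * P = D I\<close> applied to a kernel vector \<open>(u, q)\<close> of \<open>P(l)\<close>.\<close>
lemma roll_yaw_det_times_kernel:
  assumes "(l\<^sup>2 + a) * u = g * l * q" "(l\<^sup>2 + b) * q = h * l * u"
  shows "roll_yaw_det l * u = 0" "roll_yaw_det l * q = 0"
proof -
  have "roll_yaw_det l * u =
      (l\<^sup>2 + b) * ((l\<^sup>2 + a) * u - g * l * q) + g * l * ((l\<^sup>2 + b) * q - h * l * u)"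
    "roll_yaw_det l * q =
      (l\<^sup>2 + a) * ((l\<^sup>2 + b) * q - h * l * u) + h * l * ((l\<^sup>2 + a) * u - g * l * q)"
    unfolding roll_yaw_det_def by (simp_all add: algebra_simps power2_eq_square)
  with assms show "roll_yaw_det l * u = 0" "roll_yaw_det l * q = 0" by simp_all
qed

lemma eigenvalue_iff: "eigenvalue M l \<longleftrightarrow> l\<^sup>2 + c = 0 \<or> roll_yaw_det l = 0"
proof
  assume "eigenvalue M l"
  then obtain v where v: "v \<in> carrier_vec 6" "v \<noteq> 0\<^sub>v 6" "char_matrix M l *\<^sub>v v = 0\<^sub>v 6"
    unfolding eigenvalue_char_matrix[OF carrier] by blast
  obtain x y z x' y' z' where state: "v = state_vec x y z x' y' z'"
    using carrier_vec_6E[OF v(1)] .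
  from v(3) have xyz: "x' = l * x" "y' = l * y" "z' = l * z" and y: "(l\<^sup>2 + c) * y = 0"
    and xz: "(l\<^sup>2 + a) * x = g * l * z" "(l\<^sup>2 + b) * z = h * l * x"
    unfolding state char_matrix_mult_eq_0_iff by blast+
  from v(2) have "x \<noteq> 0 \<or> y \<noteq> 0 \<or> z \<noteq> 0"
    unfolding state state_vec_eq_0_iff xyz by auto
  moreover have "roll_yaw_det l * x = 0" "roll_yaw_det l * z = 0"
    using roll_yaw_det_times_kernel[OF xz] .
  ultimately show "l\<^sup>2 + c = 0 \<or> roll_yaw_det l = 0" using y by auto
next
  have eigenvalueI: "eigenvalue M l"
    if "x \<noteq> 0 \<or> y \<noteq> 0 \<or> z \<noteq> 0" "(l\<^sup>2 + c) * y = 0"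
      "(l\<^sup>2 + a) * x = g * l * z" "(l\<^sup>2 + b) * z = h * l * x" for x y z
    unfolding eigenvalue_char_matrix[OF carrier]
  proof (intro exI conjI)
    show "state_vec x y z (l * x) (l * y) (l * z) \<in> carrier_vec 6" by simp
    show "state_vec x y z (l * x) (l * y) (l * z) \<noteq> 0\<^sub>v 6"
      unfolding state_vec_eq_0_iff using that(1) by blast
    show "char_matrix M l *\<^sub>v state_vec x y z (l * x) (l * y) (l * z) = 0\<^sub>v 6"
      unfolding char_matrix_mult_eq_0_iff using that(2-4) by blast
  qed
  assume "l\<^sup>2 + c = 0 \<or> roll_yaw_det l = 0"
  \<comment> \<open>At a root of the determinant any non-zero column of \<open>adj P(l)\<close> is a kernel vector; if the
     adjugate vanishes, so does \<open>P(l)\<close>, and every vector is one.\<close>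
  then consider "l\<^sup>2 + c = 0" | "roll_yaw_det l = 0" "g * l \<noteq> 0 \<or> l\<^sup>2 + a \<noteq> 0"
    | "roll_yaw_det l = 0" "g * l = 0" "l\<^sup>2 + a = 0" by blast
  then show "eigenvalue M l"
  proof cases
    case 1
    then show ?thesis by (intro eigenvalueI[of 0 1 0]) simp_all
  next
    case 2
    then have "(l\<^sup>2 + b) * (l\<^sup>2 + a) = h * l * (g * l)"
      unfolding roll_yaw_det_def by (simp add: algebra_simps power2_eq_square)
    with 2(2) show ?thesis by (intro eigenvalueI[of "g * l" 0 "l\<^sup>2 + a"]) auto
  next
    case 3
    show ?thesis
    proof (cases "h * l = 0")
      case True
      with 3 show ?thesis by (intro eigenvalueI[of 1 0 0]) simp_all
    next
      case False
      with 3 show ?thesis by (intro eigenvalueI[of "l\<^sup>2 + b" 0 "h * l"]) simp_all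
    qed
  qed
qed

lemma multiplicities_eq_iff:
  "algebraic_multiplicity M l = geometric_multiplicity M l \<longleftrightarrow> (\<forall>x y z x' y' z'.
     char_matrix M l *\<^sub>v (char_matrix M l *\<^sub>v state_vec x y z x' y' z') = 0\<^sub>v 6 \<longrightarrow>
     char_matrix M l *\<^sub>v state_vec x y z x' y' z' = 0\<^sub>v 6)"
  unfolding algebraic_eq_geometric_iff_no_jordan_chain[OF carrier]
  by (metis carrier_vec_6E state_vec_carrier)

text \<open>
  A chain consists of an eigenvector with positions \<open>(u, r, q)\<close> and a state mapped to it. On the
  roll-yaw part it satisfies \<open>P u = 0\<close> and \<open>P x + P' u = 0\<close>, where \<open>u\<close> and \<open>x\<close> abbreviate the
  pairs \<open>(u, q)\<close> and \<open>(x, z)\<close>. Since \<open>adj P * P' + (adj P)' * P = D' I\<close>,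
  multiplying the second equation by \<open>adj P\<close> gives \<open>D x + D' u = 0\<close>; together with \<open>D u = 0\<close>
  this forces \<open>u = 0\<close> unless \<open>D\<close> and \<open>D'\<close> both vanish. The pitch part is the same argument for
  \<open>l\<^sup>2 + c\<close>, whose only possible double root is \<open>0\<close>. A common root of the two factors is harmless,
  because pitch and roll-yaw are separate invariant subspaces.
\<close>
lemma multiplicities_eq_if_simple:
  assumes pitch: "l \<noteq> 0 \<or> c \<noteq> 0"
    and simple: "roll_yaw_det l \<noteq> 0 \<or> roll_yaw_det_deriv l \<noteq> 0"
  shows "algebraic_multiplicity M l = geometric_multiplicity M l"
  unfolding multiplicities_eq_iff
proof (intro allI impI)
  fix x y z x' y' z'
  define u r q where "u = x' - l * x" and "r = y' - l * y" and "q = z' - l * z"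
  let ?D = "roll_yaw_det l" and ?D' = "roll_yaw_det_deriv l"
  assume "char_matrix M l *\<^sub>v (char_matrix M l *\<^sub>v state_vec x y z x' y' z') = 0\<^sub>v 6"
  then have velocities: "g * z' - a * x - l * x' = l * u" "- c * y - l * y' = l * r"
      "h * x' - b * z - l * z' = l * q"
    and eigenvector: "(l\<^sup>2 + c) * r = 0" "(l\<^sup>2 + a) * u = g * l * q" "(l\<^sup>2 + b) * q = h * l * u"
    unfolding char_matrix_mult[of l x y z x' y' z'] char_matrix_mult_eq_0_iff
      u_def[symmetric] r_def[symmetric] q_def[symmetric]
    by simp_all
  have "r = 0"
  proof (rule ccontr)
    assume "r \<noteq> 0"
    with eigenvector(1) have c: "l\<^sup>2 + c = 0" by simp
    have "2 * l * r = - ((l\<^sup>2 + c) * y) - ((- c * y - l * y') - l * r)"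
      unfolding r_def by (simp add: algebra_simps power2_eq_square)
    then have "2 * l * r = 0" unfolding c velocities(2) by simp
    with \<open>r \<noteq> 0\<close> have "l = 0" by simp
    with c pitch show False by simp
  qed
  moreover
  have D: "?D * u = 0" "?D * q = 0"
    using roll_yaw_det_times_kernel[OF eigenvector(2,3)] .
  have chain: "(l\<^sup>2 + a) * x - g * l * z + 2 * l * u - g * q = 0"
    "(l\<^sup>2 + b) * z - h * l * x + 2 * l * q - h * u = 0"
    using velocities(1,3) unfolding u_def q_def by (simp_all add: algebra_simps power2_eq_square)
  \<comment> \<open>The first two summands are \<open>adj P * (P x + P' u)\<close>, the last two are \<open>(adj P)' * P u\<close>.\<close>
  have "?D * x + ?D' * u =
      (l\<^sup>2 + b) * ((l\<^sup>2 + a) * x - g * l * z + 2 * l * u - g * q)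
      + g * l * ((l\<^sup>2 + b) * z - h * l * x + 2 * l * q - h * u)
      + 2 * l * ((l\<^sup>2 + a) * u - g * l * q) + g * ((l\<^sup>2 + b) * q - h * l * u)"
    unfolding roll_yaw_det_def roll_yaw_det_deriv_def
    by (simp add: algebra_simps power2_eq_square)
  then have "?D * x + ?D' * u = 0" unfolding chain using eigenvector by simp
  moreover have "?D * z + ?D' * q =
      (l\<^sup>2 + a) * ((l\<^sup>2 + b) * z - h * l * x + 2 * l * q - h * u)
      + h * l * ((l\<^sup>2 + a) * x - g * l * z + 2 * l * u - g * q)
      + 2 * l * ((l\<^sup>2 + b) * q - h * l * u) + h * ((l\<^sup>2 + a) * u - g * l * q)"
    unfolding roll_yaw_det_def roll_yaw_det_deriv_def
    by (simp add: algebra_simps power2_eq_square)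
  then have "?D * z + ?D' * q = 0" unfolding chain using eigenvector by simp
  ultimately have "u = 0" "r = 0" "q = 0" using D simple by auto
  with velocities show "char_matrix M l *\<^sub>v state_vec x y z x' y' z' = 0\<^sub>v 6"
    unfolding char_matrix_mult state_vec_eq_0_iff u_def[symmetric] r_def[symmetric] q_def[symmetric]
    by simp
qed

text \<open>Without a restoring force the pitch angle drifts: a unit pitch rate maps to a unit pitch angle.\<close>
lemma pitch_nonzero_if_multiplicities_eq:
  assumes "algebraic_multiplicity M 0 = geometric_multiplicity M 0"
  shows "c \<noteq> 0"
proof
  assume "c = 0"
  then have "char_matrix M 0 *\<^sub>v state_vec 0 1 0 0 0 0 = 0\<^sub>v 6"
    unfolding char_matrix_mult_eq_0_iff by simp
  moreover have "char_matrix M 0 *\<^sub>v state_vec 0 0 0 0 1 0 = state_vec 0 1 0 0 0 0"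
    unfolding char_matrix_mult by simp
  ultimately have "state_vec 0 1 0 0 0 0 = 0\<^sub>v 6"
    using assms unfolding multiplicities_eq_iff by metis
  then show False by (simp add: state_vec_eq_0_iff)
qed

text \<open>
  If \<open>w(l)\<close> is a column of \<open>adj P(l)\<close>, then \<open>P w\<close> has the single non-zero entry \<open>D\<close>, so at a double root
  both \<open>P w = 0\<close> and \<open>P w' + P' w = 0\<close>: the column and its derivative form a Jordan chain unless
  \<open>w = 0\<close>. Both columns vanish only if \<open>P(l) = 0\<close>, which is the conclusion.
\<close>
lemma roll_yaw_decoupled_if_multiplicities_eq:
  assumes eq: "algebraic_multiplicity M l = geometric_multiplicity M l"
    and D: "roll_yaw_det l = 0" and D': "roll_yaw_det_deriv l = 0"
  shows "l\<^sup>2 + a = 0" "g * l = 0" "l\<^sup>2 + b = 0" "h * l = 0"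
proof -
  have no_chain: "u = 0 \<and> q = 0"
    if "(l\<^sup>2 + a) * u = g * l * q" "(l\<^sup>2 + b) * q = h * l * u"
      "(l\<^sup>2 + a) * x - g * l * z + 2 * l * u - g * q = 0"
      "(l\<^sup>2 + b) * z - h * l * x + 2 * l * q - h * u = 0"
    for x z u q
  proof -
    have "g * (l * z + q) - a * x - l * (l * x + u) = l * u"
      "h * (l * x + u) - b * z - l * (l * z + q) = l * q"
      using that(3,4) by (simp_all add: algebra_simps power2_eq_square)
    then have "char_matrix M l *\<^sub>v state_vec x 0 z (l * x + u) 0 (l * z + q) =
        state_vec u 0 q (l * u) 0 (l * q)"
      unfolding char_matrix_mult by simp
    moreover have "char_matrix M l *\<^sub>v state_vec u 0 q (l * u) 0 (l * q) = 0\<^sub>v 6"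
      unfolding char_matrix_mult_eq_0_iff using that(1,2) by simp
    ultimately have "state_vec u 0 q (l * u) 0 (l * q) = 0\<^sub>v 6"
      using eq unfolding multiplicities_eq_iff by metis
    then show ?thesis by (simp add: state_vec_eq_0_iff)
  qed
  \<comment> \<open>The column \<open>(g l, l\<^sup>2 + a)\<close> and its derivative \<open>(g, 2 l)\<close>.\<close>
  have "g * l = 0 \<and> l\<^sup>2 + a = 0"
  proof (rule no_chain[where x = g and z = "2 * l"])
    show "(l\<^sup>2 + b) * (l\<^sup>2 + a) = h * l * (g * l)"
      using D unfolding roll_yaw_det_def by (simp add: algebra_simps power2_eq_square)
    show "(l\<^sup>2 + b) * (2 * l) - h * l * g + 2 * l * (l\<^sup>2 + a) - h * (g * l) = 0"
      using D' unfolding roll_yaw_det_deriv_def by (simp add: algebra_simps power2_eq_square)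
  qed (simp_all add: algebra_simps power2_eq_square)
  then show "l\<^sup>2 + a = 0" "g * l = 0" by simp_all
  \<comment> \<open>The column \<open>(l\<^sup>2 + b, h l)\<close> and its derivative \<open>(2 l, h)\<close>.\<close>
  have "l\<^sup>2 + b = 0 \<and> h * l = 0"
  proof (rule no_chain[where x = "2 * l" and z = h])
    show "(l\<^sup>2 + a) * (l\<^sup>2 + b) = g * l * (h * l)"
      using D unfolding roll_yaw_det_def by (simp add: algebra_simps power2_eq_square)
    show "(l\<^sup>2 + a) * (2 * l) - g * l * h + 2 * l * (l\<^sup>2 + b) - g * (h * l) = 0"
      using D' unfolding roll_yaw_det_deriv_def by (simp add: algebra_simps power2_eq_square)
  qed (simp_all add: algebra_simps power2_eq_square)
  then show "l\<^sup>2 + b = 0" "h * l = 0" by simp_all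
qed

end

lemma gyroscopic_attitude_matrix:
  "gyroscopic_matrix (map_mat complex_of_real (attitude_matrix w s1 s2 s3))
     (4 * w\<^sup>2 * s1) (w\<^sup>2 * s3) (3 * w\<^sup>2 * s2) (w * (1 - s1)) (w * (s3 - 1))"
proof
  show "map_mat complex_of_real (attitude_matrix w s1 s2 s3) \<in> carrier_mat 6 6"
    by (rule carrier_matI) (simp_all add: attitude_matrix_def mat_of_rows_list_def)
qed (simp add: char_matrix_attitude_matrix_mult)

section \<open>Real quadratics with non-positive roots\<close>

lemma complex_root_negative_real:
  fixes p q :: real and t :: complex
  assumes "p > 0" "q > 0" "p\<^sup>2 - 4 * q > 0" and root: "t\<^sup>2 + p * t + q = 0"
  shows "\<exists>r < 0. t = of_real r"
proof -
  define d where "d = sqrt (p\<^sup>2 - 4 * q)"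
  have d2: "d\<^sup>2 = p\<^sup>2 - 4 * q" using assms by (simp add: d_def)
  have "d \<ge> 0" using assms by (simp add: d_def)
  have "d < p" using assms d2 by (intro power_less_imp_less_base[of d 2 p]) auto
  have "complex_of_real d ^ 2 = of_real p ^ 2 - 4 * of_real q"
    using arg_cong[OF d2, of complex_of_real] by simp
  moreover have "(2 * t + p)\<^sup>2 = 4 * (t\<^sup>2 + p * t + q) + (of_real p ^ 2 - 4 * of_real q)"
    by (simp add: algebra_simps power2_eq_square)
  ultimately have "(2 * t + p)\<^sup>2 = (of_real d)\<^sup>2" using root by simp
  then have "2 * t + p = of_real d \<or> 2 * t + p = - of_real d" by (simp add: power2_eq_iff)
  then have "t = of_real ((d - p) / 2) \<or> t = of_real ((- d - p) / 2)"
    by (auto simp: field_simps)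
  moreover have "(d - p) / 2 < 0" "(- d - p) / 2 < 0" using \<open>d \<ge> 0\<close> \<open>d < p\<close> by simp_all
  ultimately show ?thesis by blast
qed

text \<open>
  The two roots are \<open>(- p \<plusminus> s) / 2\<close> with \<open>s\<^sup>2 = p\<^sup>2 - 4 q\<close>. If both are real, so is \<open>s\<close>, which makes
  the discriminant a real square; if both are non-positive, then \<open>\<bar>s\<bar> \<le> p\<close>, which gives \<open>p \<ge> 0\<close> and,
  after squaring, \<open>q \<ge> 0\<close>.
\<close>
lemma real_quadratic_if_complex_roots_nonpos:
  fixes p q :: real
  assumes "\<And>t :: complex. t\<^sup>2 + p * t + q = 0 \<Longrightarrow> Im t = 0 \<and> Re t \<le> 0"
  shows "p \<ge> 0" "q \<ge> 0" "p\<^sup>2 - 4 * q \<ge> 0"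
proof -
  define s where "s = csqrt (of_real (p\<^sup>2 - 4 * q))"
  have s2: "s\<^sup>2 = of_real p ^ 2 - 4 * of_real q" by (simp add: s_def)
  have
    "((- p + s) / 2)\<^sup>2 + p * ((- p + s) / 2) + q = (s\<^sup>2 - (of_real p ^ 2 - 4 * of_real q)) / 4"
    "((- p - s) / 2)\<^sup>2 + p * ((- p - s) / 2) + q = (s\<^sup>2 - (of_real p ^ 2 - 4 * of_real q)) / 4"
    by (simp_all add: field_simps power2_eq_square)
  then have "((- p + s) / 2)\<^sup>2 + p * ((- p + s) / 2) + q = 0"
    "((- p - s) / 2)\<^sup>2 + p * ((- p - s) / 2) + q = 0"
    unfolding s2 by simp_all
  from this[THEN assms] have s: "Im s = 0" "\<bar>Re s\<bar> \<le> p" by auto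
  have "(Re s)\<^sup>2 = p\<^sup>2 - 4 * q"
    using arg_cong[OF s2, of Re] s(1) by (simp add: power2_eq_square)
  moreover have "(Re s)\<^sup>2 \<le> p\<^sup>2" using s(2) by (simp add: abs_le_square_iff[symmetric])
  ultimately show "p \<ge> 0" "q \<ge> 0" "p\<^sup>2 - 4 * q \<ge> 0" using s(2) zero_le_power2[of "Re s"] by auto
qed

lemma Re_eq_0_if_square_neg:
  assumes "l\<^sup>2 = complex_of_real r" "r < 0"
  shows "Re l = 0"
proof -
  from assms(1) have "Re l * Im l = 0" "(Re l)\<^sup>2 - (Im l)\<^sup>2 = r"
    by (auto simp: complex_eq_iff power2_eq_square)
  with assms(2) show ?thesis using zero_le_power2[of "Re l"] by auto
qed

section \<open>Stability of the attitude matrix\<close>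

theorem theorem1:
  fixes J\<^sub>x J\<^sub>y J\<^sub>z \<omega>\<^sub>0 \<sigma>\<^sub>1 \<sigma>\<^sub>2 \<sigma>\<^sub>3 \<phi>\<^sub>1 \<phi>\<^sub>2 :: real
  assumes "J\<^sub>x > 0" and "J\<^sub>y > 0" and "J\<^sub>z > 0" and "\<omega>\<^sub>0 > 0"
    and "\<sigma>\<^sub>1 = (J\<^sub>y - J\<^sub>z) / J\<^sub>x"
    and "\<sigma>\<^sub>2 = (J\<^sub>x - J\<^sub>z) / J\<^sub>y"
    and "\<sigma>\<^sub>3 = (J\<^sub>y - J\<^sub>x) / J\<^sub>z"
    and "\<phi>\<^sub>1 = \<sigma>\<^sub>1 * \<sigma>\<^sub>3"
    and "\<phi>\<^sub>2 = 3 * \<sigma>\<^sub>1 + \<sigma>\<^sub>3 * \<sigma>\<^sub>1 + 1"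
  shows "lyapunov_stable (attitude_matrix \<omega>\<^sub>0 \<sigma>\<^sub>1 \<sigma>\<^sub>2 \<sigma>\<^sub>3) \<longleftrightarrow>
    0 < \<sigma>\<^sub>2 \<and> 0 < \<phi>\<^sub>1 \<and> 0 < \<phi>\<^sub>2 \<and> 0 < \<phi>\<^sub>2\<^sup>2 - 16 * \<phi>\<^sub>1"
proof -
  define M where "M = map_mat complex_of_real (attitude_matrix \<omega>\<^sub>0 \<sigma>\<^sub>1 \<sigma>\<^sub>2 \<sigma>\<^sub>3)"
  define p q where "p = \<omega>\<^sub>0\<^sup>2 * \<phi>\<^sub>2" and "q = 4 * \<omega>\<^sub>0 ^ 4 * \<phi>\<^sub>1"
  interpret gyroscopic_matrix M "4 * \<omega>\<^sub>0\<^sup>2 * \<sigma>\<^sub>1" "\<omega>\<^sub>0\<^sup>2 * \<sigma>\<^sub>3" "3 * \<omega>\<^sub>0\<^sup>2 * \<sigma>\<^sub>2"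
      "\<omega>\<^sub>0 * (1 - \<sigma>\<^sub>1)" "\<omega>\<^sub>0 * (\<sigma>\<^sub>3 - 1)"
    unfolding M_def by (rule gyroscopic_attitude_matrix)
  have disc: "p\<^sup>2 - 4 * q = \<omega>\<^sub>0 ^ 4 * (\<phi>\<^sub>2\<^sup>2 - 16 * \<phi>\<^sub>1)"
    unfolding p_def q_def by (simp add: algebra_simps power_mult_distrib)
  have D: "roll_yaw_det l = (l\<^sup>2)\<^sup>2 + p * l\<^sup>2 + q"
    and D': "roll_yaw_det_deriv l = 2 * l * (2 * l\<^sup>2 + p)" for l :: complex
    unfolding roll_yaw_det_def roll_yaw_det_deriv_def p_def q_def assms(8,9)
    by (simp_all add: algebra_simps power2_eq_square power4_eq_xxxx)
  have stable_iff: "lyapunov_stable (attitude_matrix \<omega>\<^sub>0 \<sigma>\<^sub>1 \<sigma>\<^sub>2 \<sigma>\<^sub>3) \<longleftrightarrow>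
      (\<forall>l. eigenvalue M l \<longrightarrow> Re l \<le> 0) \<and>
      (\<forall>l. eigenvalue M l \<and> Re l = 0 \<longrightarrow>
         algebraic_multiplicity M l = geometric_multiplicity M l)"
    by (simp add: lyapunov_stable_def Let_def M_def attitude_matrix_def mat_of_rows_list_def)
  show ?thesis
  proof
    assume stable: "lyapunov_stable (attitude_matrix \<omega>\<^sub>0 \<sigma>\<^sub>1 \<sigma>\<^sub>2 \<sigma>\<^sub>3)"
    \<comment> \<open>The eigenvalue equation contains only \<open>l\<^sup>2\<close>.\<close>
    have imaginary: "Re l = 0" if "eigenvalue M l" for l
    proof -
      have "eigenvalue M (- l)" using that unfolding eigenvalue_iff D by simp
      with that have "Re l \<le> 0" "Re (- l) \<le> 0" using stable unfolding stable_iff by blast+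
      then show ?thesis by simp
    qed
    have multiplicities: "algebraic_multiplicity M l = geometric_multiplicity M l"
      if "eigenvalue M l" for l
      using stable imaginary that unfolding stable_iff by blast
    have square: "Im (l\<^sup>2) = 0 \<and> Re (l\<^sup>2) \<le> 0" if "eigenvalue M l" for l
      using imaginary[OF that] by (simp add: power2_eq_square)
    have "\<sigma>\<^sub>2 \<ge> 0"
    proof -
      have "eigenvalue M (csqrt (- of_real (3 * \<omega>\<^sub>0\<^sup>2 * \<sigma>\<^sub>2)))"
        unfolding eigenvalue_iff by simp
      from square[OF this] have "3 * \<omega>\<^sub>0\<^sup>2 * \<sigma>\<^sub>2 \<ge> 0" by (simp del: of_real_mult)
      with \<open>\<omega>\<^sub>0 > 0\<close> show ?thesis by (simp add: zero_le_mult_iff)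
    qed
    moreover have "\<sigma>\<^sub>2 \<noteq> 0"
    proof
      assume "\<sigma>\<^sub>2 = 0"
      then have "eigenvalue M 0" unfolding eigenvalue_iff by simp
      from pitch_nonzero_if_multiplicities_eq[OF multiplicities[OF this]]
      show False using \<open>\<sigma>\<^sub>2 = 0\<close> by simp
    qed
    ultimately have "\<sigma>\<^sub>2 > 0" by simp

    have quadratic: "Im t = 0 \<and> Re t \<le> 0" if "t\<^sup>2 + p * t + q = 0" for t :: complex
    proof -
      have "eigenvalue M (csqrt t)" unfolding eigenvalue_iff D using that by simp
      from square[OF this] show ?thesis by simp
    qed
    note nonneg = real_quadratic_if_complex_roots_nonpos[of p q, OF quadratic]
    have eigenvalue_if_root: "eigenvalue M l" if "roll_yaw_det l = 0" for l
      using that unfolding eigenvalue_iff by simp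
    note decoupled =
      roll_yaw_decoupled_if_multiplicities_eq[OF multiplicities[OF eigenvalue_if_root]]
    have "q \<noteq> 0"
    proof
      assume "q = 0"
      then have "roll_yaw_det 0 = 0" "roll_yaw_det_deriv 0 = 0" unfolding D D' by simp_all
      from decoupled[OF this(1) this] \<open>\<omega>\<^sub>0 > 0\<close> have "\<sigma>\<^sub>1 = 0" "\<sigma>\<^sub>3 = 0" by simp_all
      \<comment> \<open>All three inertias are equal.\<close>
      then have "\<sigma>\<^sub>2 = 0" using assms by simp
      with \<open>\<sigma>\<^sub>2 > 0\<close> show False by simp
    qed
    moreover have "p\<^sup>2 - 4 * q \<noteq> 0"
    proof
      assume "p\<^sup>2 - 4 * q = 0"
      \<comment> \<open>A vanishing discriminant puts the double root at \<open>l\<^sup>2 = - p / 2\<close>.\<close>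
      define l where "l = csqrt (- of_real p / 2)"
      have l2: "l\<^sup>2 = - of_real p / 2" by (simp add: l_def)
      have "p\<^sup>2 = 4 * q" using \<open>p\<^sup>2 - 4 * q = 0\<close> by simp
      then have pq: "of_real p ^ 2 = (4 * of_real q :: complex)"
        by (metis of_real_mult of_real_numeral of_real_power)
      have "roll_yaw_det l = 0" "roll_yaw_det_deriv l = 0"
        unfolding D D' l2 using pq by (simp_all add: field_simps power2_eq_square)
      note eqs = decoupled[OF this(1) this]
      from \<open>q \<noteq> 0\<close> pq l2 have "l \<noteq> 0" by auto
      with eqs \<open>\<omega>\<^sub>0 > 0\<close> have "complex_of_real \<sigma>\<^sub>1 = 1" "complex_of_real \<sigma>\<^sub>3 = 1" by auto
      with eqs(1,3) have "l\<^sup>2 = - (4 * complex_of_real \<omega>\<^sub>0 ^ 2)" "l\<^sup>2 = - (complex_of_real \<omega>\<^sub>0 ^ 2)"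
        by (simp_all add: eq_neg_iff_add_eq_0)
      with \<open>\<omega>\<^sub>0 > 0\<close> show False by simp
    qed
    ultimately have pos: "q > 0" "p\<^sup>2 - 4 * q > 0" using nonneg by auto
    then have "p \<noteq> 0" by auto
    with nonneg have "p > 0" by simp
    with pos \<open>\<sigma>\<^sub>2 > 0\<close> show "0 < \<sigma>\<^sub>2 \<and> 0 < \<phi>\<^sub>1 \<and> 0 < \<phi>\<^sub>2 \<and> 0 < \<phi>\<^sub>2\<^sup>2 - 16 * \<phi>\<^sub>1"
      using \<open>\<omega>\<^sub>0 > 0\<close> unfolding disc by (simp add: p_def q_def zero_less_mult_iff)
  next
    assume "0 < \<sigma>\<^sub>2 \<and> 0 < \<phi>\<^sub>1 \<and> 0 < \<phi>\<^sub>2 \<and> 0 < \<phi>\<^sub>2\<^sup>2 - 16 * \<phi>\<^sub>1"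
    then have "\<sigma>\<^sub>2 > 0" and pos: "p > 0" "q > 0" "p\<^sup>2 - 4 * q > 0"
      using \<open>\<omega>\<^sub>0 > 0\<close> unfolding disc by (simp_all add: p_def q_def)
    have "Re l = 0" if "eigenvalue M l" for l
    proof -
      from that consider "l\<^sup>2 + 3 * \<omega>\<^sub>0\<^sup>2 * \<sigma>\<^sub>2 = 0" | "roll_yaw_det l = 0"
        unfolding eigenvalue_iff by blast
      then have "\<exists>r < 0. l\<^sup>2 = of_real r"
      proof cases
        case 1
        then have "l\<^sup>2 = of_real (- 3 * \<omega>\<^sub>0\<^sup>2 * \<sigma>\<^sub>2)" by (simp add: eq_neg_iff_add_eq_0)
        then show ?thesis using \<open>\<sigma>\<^sub>2 > 0\<close> \<open>\<omega>\<^sub>0 > 0\<close>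
          by (intro exI[of _ "- 3 * \<omega>\<^sub>0\<^sup>2 * \<sigma>\<^sub>2"]) auto
      next
        case 2
        then show ?thesis using complex_root_negative_real[OF pos] unfolding D by blast
      qed
      then show ?thesis using Re_eq_0_if_square_neg by blast
    qed
    moreover have "algebraic_multiplicity M l = geometric_multiplicity M l" for l
    proof (rule multiplicities_eq_if_simple)
      show "l \<noteq> 0 \<or> 3 * \<omega>\<^sub>0\<^sup>2 * \<sigma>\<^sub>2 \<noteq> (0 :: complex)"
        using \<open>\<sigma>\<^sub>2 > 0\<close> \<open>\<omega>\<^sub>0 > 0\<close> by simp
      show "roll_yaw_det l \<noteq> 0 \<or> roll_yaw_det_deriv l \<noteq> 0"
      proof (rule ccontr)
        assume "\<not> ?thesis"
        then have root: "(l\<^sup>2)\<^sup>2 + p * l\<^sup>2 + q = 0" and "2 * l * (2 * l\<^sup>2 + p) = 0"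
          unfolding D D' by auto
        moreover from root \<open>q > 0\<close> have "l \<noteq> 0" by auto
        ultimately have "2 * l\<^sup>2 + p = 0" by simp
        then have t: "l\<^sup>2 = - of_real p / 2" by (simp add: field_simps eq_neg_iff_add_eq_0)
        from root have "of_real p ^ 2 - 4 * of_real q = (0 :: complex)"
          unfolding t by (simp add: field_simps power2_eq_square)
        then have "of_real (p\<^sup>2 - 4 * q) = (0 :: complex)" by simp
        with pos(3) show False by (simp only: of_real_eq_0_iff)
      qed
    qed
    ultimately show "lyapunov_stable (attitude_matrix \<omega>\<^sub>0 \<sigma>\<^sub>1 \<sigma>\<^sub>2 \<sigma>\<^sub>3)"
      unfolding stable_iff by simp
  qed
qed

end
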